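(* Let $1\le q<n\le m$ be integers, and let $R(\lambda,\boldsymbol\theta)$, with parameter vector $\boldsymbol\theta=(b_1,\dots,b_m,a_{q+1},\dots,a_n)$, be the parametric stability function defined in the context. Let $\boldsymbol\theta^*$ be any optimal choice of $\boldsymbol\theta$, that is, any solution of the constrained problem of minimizing the convergence factor $\kappa_c(r,R(\cdot,\boldsymbol\theta);J_0)$ over $\boldsymbol\theta$ subject to the order constraints $a_k=\sum_{j=0}^k c_je^{b_{k-j}}$, $k=0,\dots,q$, and the stability constraint $|R(\lambda,\boldsymbol\theta)|<1$ for all $\lambda>0$. Then the associated optimized coarse propagator (OCP), with stability function $R(\cdot,\boldsymbol\theta^* )$ and functions $P_i(\cdot,\boldsymbol\theta^* )$ as described in the context, is consistent and has an accuracy of order $q$, i.e., as $\lambda\to0$, $$R(\lambda,\boldsymbol\theta^* )=e^{-\lambda}+\mathcal O(\lambda^{q+1})$$ and, for every $0\le j\le q$, $$\sum_{i=1}^{M} C_i^jP_i(\lambda,\boldsymbol\theta^* )-\frac{j!}{(-\lambda)^{j+1}}\Big(e^{-\lambda}-\sum_{\ell=0}^j\frac{(-\lambda)^\ell}{\ell!}\Big)=\mathcal O(\lambda^{q-j}).$$ Furthermore, it is strongly stable: $$|R(\lambda,\boldsymbol\theta^* )|<1\ \text{ for all }\lambda>0\quad\text{and}\quad|R(\infty,\boldsymbol\theta^* )|<1 .$$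
   Context: Setting: $\mathcal A$ is a positive definite, self-adjoint linear operator with compact inverse on a Hilbert space, with eigenvalues $0<\lambda_1\le\lambda_2\le\cdots$, $\lambda_j\to\infty$. The parareal algorithm for $u'+\mathcal A u=f$ uses a coarse time step $\Delta T$ and a fine time step. The fine propagator is a given single step scheme with rational stability function $r$ satisfying $|r(\lambda)|<1$ for $\lambda>0$, $|r(\infty)|<1$, and $r(\lambda)=e^{-\lambda}+\mathcal O(\lambda^{q_f+1})$ as $\lambda\to0$, where $q_f$ is its order. $J_0\in\mathbb N$ is the ratio of coarse to fine step size used in the optimization. Parametric stability function of the coarse propagator: $$R(\lambda,\boldsymbol\theta)=\frac{\sum_{i=0}^n a_i\lambda^i}{1+\sum_{i=1}^m e^{b_i}\lambda^i},$$ with real parameters $\boldsymbol\theta=(b_1,\dots,b_m,a_{q+1},\dots,a_n)$; the coefficients $a_0,\dots,a_q$ are not free but are determined by the order constraints in the claim, where $c_j=(-1)^j/j!$ (so $e^{-\lambda}=\sum_j c_j\lambda^j$) and $b_0=0$ by convention. $R(\infty,\boldsymbol\theta)=\lim_{\lambda\to\infty}R(\lambda,\boldsymbol\theta)$. Convergence factor: $$\kappa_c(r,R;J_0)=\sup_{s\in\Lambda}\left|\frac{r(s/J_0)^{J_0}-R(s)}{1-|R(s)|}\right|,\qquad \Lambda=\{\Delta T\lambda_j\}_{j=1}^\infty .$$ Optimized coarse propagator: with $M$ stages and distinct nodes $C_i$ uniformly distributed in $[0,1]$ (for a single stage, $C_1=1$), rational functions $P_i(\cdot,\boldsymbol\theta^*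 )$, bounded on $(0,\infty)$, are obtained by solving the linear equations expressing strict accuracy of order $q$, $$\sum_{i=1}^{M} C_i^jP_i(\lambda,\boldsymbol\theta^* )-\frac{j!}{(-\lambda)^{j+1}}\Big(R(\lambda,\boldsymbol\theta^* )-\sum_{\ell=0}^j\frac{(-\lambda)^\ell}{\ell!}\Big)=0,\qquad 0\le j\le q-1$$ (with $0^0=1$). The OCP over a coarse step starting at time $t$ with initial value $v$ is $$\mathcal G(t,\Delta T,v,f)=R(\Delta T\mathcal A,\boldsymbol\theta^* )v+\Delta T\sum_{i=1}^{M}P_i(\Delta T\mathcal A,\boldsymbol\theta^* )f(t+C_i\Delta T).$$ *)

theory Defs
  imports
    "HOL-Analysis.Analysis"
    "HOL-Library.Landau_Symbols"
    "HOL-Computational_Algebra.Computational_Algebra"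
begin

(* An unbounded operator is a pair of a domain D and a map A, of which only the values on D
   matter.  The fourth clause says that the graph of the adjoint is the graph of A, i.e.
   self-adjointness including equality of the domains.  The base field is real; for a complex
   Hilbert space take the real part of the inner product. *)
definition posdef_selfadjoint_compact_inverse ::
    "'a::{real_inner,complete_space} set \<Rightarrow> ('a \<Rightarrow> 'a) \<Rightarrow> bool" where
  "posdef_selfadjoint_compact_inverse D A \<longleftrightarrow>
     subspace D \<and> closure D = UNIV \<and>
     (\<forall>x\<in>D. \<forall>y\<in>D. \<forall>c d. A (c *\<^sub>R x + d *\<^sub>R y) = c *\<^sub>R A x + d *\<^sub>R A y) \<and>
     (\<forall>y z. (\<forall>x\<in>D. inner (A x) y = inner x z) \<longleftrightarrow> y \<in> D \<and> z = A y) \<and>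
     (\<forall>x\<in>D. x \<noteq> 0 \<longrightarrow> inner (A x) x > 0) \<and>
     bij_betw A D UNIV \<and> compact (closure (inv_into D A ` cball 0 1))"

(* lam lists the eigenvalues with multiplicity; indices start at 0, so lam j is the (j+1)-st
   eigenvalue. *)
definition eigensystem ::
    "'a::{real_inner,complete_space} set \<Rightarrow> ('a \<Rightarrow> 'a) \<Rightarrow> (nat \<Rightarrow> real) \<Rightarrow> (nat \<Rightarrow> 'a) \<Rightarrow> bool" where
  "eigensystem D A lam \<phi> \<longleftrightarrow>
     (\<forall>j. \<phi> j \<in> D \<and> A (\<phi> j) = lam j *\<^sub>R \<phi> j) \<and>
     (\<forall>i j. inner (\<phi> i) (\<phi> j) = (if i = j then 1 else 0)) \<and>
     closure (span (range \<phi>)) = UNIV \<and>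
     (\<forall>j. 0 < lam j) \<and> mono lam \<and> filterlim lam at_top sequentially"

(* F(h A) v for the operator A with the eigensystem lam, \<phi>. *)
definition spectral_calculus ::
    "(nat \<Rightarrow> real) \<Rightarrow> (nat \<Rightarrow> 'a::{real_inner,complete_space}) \<Rightarrow> (real \<Rightarrow> real) \<Rightarrow> real \<Rightarrow> 'a \<Rightarrow> 'a" where
  "spectral_calculus lam \<phi> F h v = (\<Sum>j. (F (h * lam j) * inner v (\<phi> j)) *\<^sub>R \<phi> j)"

(* Lowest terms matter: removable singularities are removed, and a pole, where the division
   returns 0, makes the function unbounded nearby. *)
definition rational_function :: "(real \<Rightarrow> real) \<Rightarrow> bool" where
  "rational_function f \<longleftrightarrow>
     (\<exists>p d. d \<noteq> 0 \<and> coprime p d \<and> (\<forall>x. f x = poly p x / poly d x))"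

definition strongly_stable :: "(real \<Rightarrow> real) \<Rightarrow> bool" where
  "strongly_stable R \<longleftrightarrow>
     (\<forall>x>0. \<bar>R x\<bar> < 1) \<and> (\<exists>L. (R \<longlongrightarrow> L) at_top \<and> \<bar>L\<bar> < 1)"

(* Of the sequences a and b only a 0, ..., a n and b 1, ..., b m enter. *)
definition param_stab ::
    "nat \<Rightarrow> nat \<Rightarrow> (nat \<Rightarrow> real) \<Rightarrow> (nat \<Rightarrow> real) \<Rightarrow> real \<Rightarrow> real" where
  "param_stab n m a b x = (\<Sum>i=0..n. a i * x ^ i) / (1 + (\<Sum>i=1..m. exp (b i) * x ^ i))"

definition order_constraints :: "nat \<Rightarrow> (nat \<Rightarrow> real) \<Rightarrow> (nat \<Rightarrow> real) \<Rightarrow> bool" where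
  "order_constraints q a b \<longleftrightarrow>
     b 0 = 0 \<and> (\<forall>k\<le>q. a k = (\<Sum>j=0..k. (-1) ^ j / fact j * exp (b (k - j))))"

definition feasible ::
    "nat \<Rightarrow> nat \<Rightarrow> nat \<Rightarrow> (nat \<Rightarrow> real) \<Rightarrow> (nat \<Rightarrow> real) \<Rightarrow> bool" where
  "feasible q n m a b \<longleftrightarrow>
     order_constraints q a b \<and> (\<forall>x>0. \<bar>param_stab n m a b x\<bar> < 1)"

(* Extended real, because the supremum may be infinite. *)
definition conv_factor ::
    "real set \<Rightarrow> (real \<Rightarrow> real) \<Rightarrow> (real \<Rightarrow> real) \<Rightarrow> nat \<Rightarrow> ereal" where
  "conv_factor \<Lambda> r R J0 =
     (SUP s\<in>\<Lambda>. ereal \<bar>(r (s / real J0) ^ J0 - R s) / (1 - \<bar>R s\<bar>)\<bar>)"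

definition optimal ::
    "real set \<Rightarrow> (real \<Rightarrow> real) \<Rightarrow> nat \<Rightarrow> nat \<Rightarrow> nat \<Rightarrow> nat \<Rightarrow>
     (nat \<Rightarrow> real) \<Rightarrow> (nat \<Rightarrow> real) \<Rightarrow> bool" where
  "optimal \<Lambda> r J0 q n m a b \<longleftrightarrow>
     feasible q n m a b \<and>
     (\<forall>a' b'. feasible q n m a' b' \<longrightarrow>
        conv_factor \<Lambda> r (param_stab n m a b) J0 \<le> conv_factor \<Lambda> r (param_stab n m a' b') J0)"

definition uniform_nodes :: "nat \<Rightarrow> (nat \<Rightarrow> real) \<Rightarrow> bool" where
  "uniform_nodes M C \<longleftrightarrow>
     (\<forall>i\<in>{1..M}. 0 \<le> C i \<and> C i \<le> 1) \<and>
     (\<exists>h>0. \<forall>i\<in>{1..<M}. C (Suc i) = C i + h) \<and>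
     (M = 1 \<longrightarrow> C 1 = 1)"

definition propagator ::
    "(nat \<Rightarrow> real) \<Rightarrow> (nat \<Rightarrow> 'a::{real_inner,complete_space}) \<Rightarrow> (real \<Rightarrow> real) \<Rightarrow>
     nat \<Rightarrow> (nat \<Rightarrow> real) \<Rightarrow> (nat \<Rightarrow> real \<Rightarrow> real) \<Rightarrow>
     real \<Rightarrow> real \<Rightarrow> 'a \<Rightarrow> (real \<Rightarrow> 'a) \<Rightarrow> 'a" where
  "propagator lam \<phi> R M C P t h v f =
     spectral_calculus lam \<phi> R h v +
     h *\<^sub>R (\<Sum>i=1..M. spectral_calculus lam \<phi> (P i) h (f (t + C i * h)))"

(* G is the optimized coarse propagator built from the stability function R. *)
definition is_ocp ::
    "(nat \<Rightarrow> real) \<Rightarrow> (nat \<Rightarrow> 'a::{real_inner,complete_space}) \<Rightarrow> nat \<Rightarrow> (real \<Rightarrow> real) \<Rightarrow>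
     nat \<Rightarrow> (nat \<Rightarrow> real) \<Rightarrow> (nat \<Rightarrow> real \<Rightarrow> real) \<Rightarrow>
     (real \<Rightarrow> real \<Rightarrow> 'a \<Rightarrow> (real \<Rightarrow> 'a) \<Rightarrow> 'a) \<Rightarrow> bool" where
  "is_ocp lam \<phi> q R M C P G \<longleftrightarrow>
     1 \<le> M \<and> uniform_nodes M C \<and>
     (\<forall>i\<in>{1..M}. rational_function (P i) \<and> bounded (P i ` {0<..})) \<and>
     (\<forall>j<q. \<forall>x>0.
        (\<Sum>i=1..M. C i ^ j * P i x)
          - fact j / (- x) ^ (j + 1) * (R x - (\<Sum>l=0..j. (- x) ^ l / fact l)) = 0) \<and>
     G = propagator lam \<phi> R M C P"

end

theory Submission
  imports Defs
begin

text \<open>Truncating the product of the denominator with the exponential series at degree q gives the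
  order of R, and the order conditions for the P i with j < q then follow from the defining
  equations of the propagator, which extend from positive arguments to a neighbourhood of 0 because
  all functions involved are rational; for j = q only boundedness near 0 is needed. For strong
  stability, a limit of modulus 1 at infinity would force an infinite convergence factor, since
  r has a limit of modulus less than 1. This contradicts optimality because a feasible choice with
  finite convergence factor exists: all b i = 0 and a i = 0 for i > q, which makes every
  coefficient of the numerator a partial sum of the series of exp (-1), hence in [0, 1].\<close>

section \<open>Rational functions without a pole at a given point\<close>

text \<open>The value of \<open>f\<close> is left open at the zeros of \<open>d\<close>. There
  division returns 0, and an equation demanded everywhere would not survive sums: at a zero of
  \<open>d'\<close> alone, \<open>p / d + 0\<close> differs from the 0 that the common denominator
  \<open>d * d'\<close> yields.\<close>

definition regular_rational_at :: "real \<Rightarrow> (real \<Rightarrow> real) \<Rightarrow> bool" where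
  "regular_rational_at c f \<longleftrightarrow>
     (\<exists>p d. poly d c \<noteq> 0 \<and> (\<forall>x. poly d x \<noteq> 0 \<longrightarrow> f x = poly p x / poly d x))"

lemma regular_rational_at_poly: "regular_rational_at c (poly p)"
  unfolding regular_rational_at_def by (rule exI[of _ p], rule exI[of _ 1]) simp

lemma regular_rational_at_mult:
  assumes "regular_rational_at c f" "regular_rational_at c g"
  shows "regular_rational_at c (\<lambda>x. f x * g x)"
proof -
  obtain p d p' d' where *: "poly d c \<noteq> 0" "\<And>x. poly d x \<noteq> 0 \<Longrightarrow> f x = poly p x / poly d x"
    "poly d' c \<noteq> 0" "\<And>x. poly d' x \<noteq> 0 \<Longrightarrow> g x = poly p' x / poly d' x"
    using assms unfolding regular_rational_at_def by blast
  show ?thesis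
    unfolding regular_rational_at_def
    by (rule exI[of _ "p * p'"], rule exI[of _ "d * d'"]) (use * in simp)
qed

lemma regular_rational_at_add:
  assumes "regular_rational_at c f" "regular_rational_at c g"
  shows "regular_rational_at c (\<lambda>x. f x + g x)"
proof -
  obtain p d p' d' where *: "poly d c \<noteq> 0" "\<And>x. poly d x \<noteq> 0 \<Longrightarrow> f x = poly p x / poly d x"
    "poly d' c \<noteq> 0" "\<And>x. poly d' x \<noteq> 0 \<Longrightarrow> g x = poly p' x / poly d' x"
    using assms unfolding regular_rational_at_def by blast
  show ?thesis
    unfolding regular_rational_at_def
    by (rule exI[of _ "p * d' + p' * d"], rule exI[of _ "d * d'"])
       (use * in \<open>simp add: field_simps\<close>)
qed

lemma regular_rational_at_const: "regular_rational_at c (\<lambda>x. k)"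
  unfolding regular_rational_at_def by (rule exI[of _ "[:k:]"], rule exI[of _ 1]) simp

lemma regular_rational_at_sum:
  assumes "\<And>i. i \<in> I \<Longrightarrow> regular_rational_at c (f i)"
  shows "regular_rational_at c (\<lambda>x. \<Sum>i\<in>I. f i x)"
  using assms
  by (induction I rule: infinite_finite_induct)
     (auto intro!: regular_rational_at_const regular_rational_at_add)

lemma eventually_poly_nonzero:
  fixes d :: "real poly"
  assumes "poly d c \<noteq> 0"
  shows "eventually (\<lambda>x. poly d x \<noteq> 0) (nhds c)"
proof -
  have "(poly d \<longlongrightarrow> poly d c) (nhds c)"
    using poly_isCont[of c d] by (simp add: isCont_def tendsto_at_iff_tendsto_nhds)
  then show ?thesis
    using assms by (rule tendsto_imp_eventually_ne)
qed

lemma regular_rational_at_bigo: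
  assumes "regular_rational_at c f"
  shows "f \<in> O[at c](\<lambda>x. 1)"
proof -
  obtain p d where *: "poly d c \<noteq> 0" "\<And>x. poly d x \<noteq> 0 \<Longrightarrow> f x = poly p x / poly d x"
    using assms unfolding regular_rational_at_def by blast
  have "((\<lambda>x. poly p x / poly d x) \<longlongrightarrow> poly p c / poly d c) (at c)"
    using *(1) by (intro tendsto_intros)
  moreover have "eventually (\<lambda>x. poly p x / poly d x = f x) (at c)"
    using eventually_poly_nonzero[OF *(1)] unfolding eventually_at_filter
    by eventually_elim (simp add: *(2))
  ultimately have "(f \<longlongrightarrow> poly p c / poly d c) (at c)"
    by (rule Lim_transform_eventually)
  then show ?thesis
    by (intro bigoI_tendsto[where c = "poly p c / poly d c"]) simp_all
qed

text \<open>An identity theorem: a numerator with infinitely many zeros is the zero polynomial, so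
  vanishing to the right of \<open>c\<close> carries over to the left.\<close>

lemma regular_rational_at_eventually_zero:
  assumes "regular_rational_at c f" and "\<And>x. x > c \<Longrightarrow> f x = 0"
  shows "eventually (\<lambda>x. f x = 0) (at c)"
proof -
  obtain p d where *: "poly d c \<noteq> 0" "\<And>x. poly d x \<noteq> 0 \<Longrightarrow> f x = poly p x / poly d x"
    using assms(1) unfolding regular_rational_at_def by blast
  \<comment> \<open>The factor \<open>d\<close> covers the points where \<open>d\<close> vanishes
    and \<open>f\<close> carries no information about \<open>p\<close>.\<close>
  have "poly (p * d) x = 0" if "x > c" for x
    using assms(2)[OF that] *(2)[of x] by (cases "poly d x = 0") auto
  then have "{c<..} \<subseteq> {x. poly (p * d) x = 0}"
    by auto
  then have "p * d = 0"
    using infinite_Ioi[of c] poly_roots_finite[of "p * d"] finite_subset by blast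
  moreover have "d \<noteq> 0"
    using *(1) by auto
  ultimately have "p = 0"
    by simp
  then show ?thesis
    using eventually_poly_nonzero[OF *(1)] unfolding eventually_at_filter
    by (auto elim!: eventually_mono simp: *(2))
qed

text \<open>If \<open>d\<close> vanished at \<open>c\<close>, the bound
  \<open>\<bar>p\<bar> \<le> B * \<bar>d\<bar>\<close> to the right of \<open>c\<close> would pass
  to the limit and force \<open>p\<close> to vanish there too, against coprimality. A one-sided
  bound thus gives two-sided regularity.\<close>

lemma bounded_rational_function_regular:
  assumes "rational_function f" and "bounded (f ` {c<..})"
  shows "regular_rational_at c f"
proof -
  obtain p d where d: "d \<noteq> 0" and cop: "coprime p d" and f: "\<And>x. f x = poly p x / poly d x"
    using assms(1) unfolding rational_function_def by blast
  obtain B where B: "\<And>x. x > c \<Longrightarrow> \<bar>f x\<bar> \<le> B"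
    using assms(2) unfolding bounded_iff by auto
  have "poly d c \<noteq> 0"
  proof
    assume 0: "poly d c = 0"
    have "eventually (\<lambda>x. poly d x \<noteq> 0) (at c)"
      using islimpt_finite[OF poly_roots_finite[OF d], of c]
      by (simp add: islimpt_iff_eventually)
    then have "eventually (\<lambda>x. poly d x \<noteq> 0) (at_right c)"
      by (auto simp: eventually_at_split)
    then have le: "eventually (\<lambda>x. \<bar>poly p x\<bar> \<le> B * \<bar>poly d x\<bar>) (at_right c)"
      using eventually_at_right_less[of c]
    proof eventually_elim
      case (elim x)
      then show ?case
        using B[of x] by (simp add: f divide_simps)
    qed
    have "\<bar>poly p c\<bar> \<le> B * \<bar>poly d c\<bar>"
    proof (rule tendsto_le[OF _ _ _ le])
      show "((\<lambda>x. B * \<bar>poly d x\<bar>) \<longlongrightarrow> B * \<bar>poly d c\<bar>) (at_right c)"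
        by (intro tendsto_intros)
      show "((\<lambda>x. \<bar>poly p x\<bar>) \<longlongrightarrow> \<bar>poly p c\<bar>) (at_right c)"
        by (intro tendsto_intros)
    qed simp
    with 0 have "poly p c = 0"
      by simp
    with 0 have "[:-c, 1:] dvd p" "[:-c, 1:] dvd d"
      by (simp_all add: poly_eq_0_iff_dvd)
    with cop have "is_unit [:-c, 1:]"
      by (rule coprime_common_divisor)
    then show False
      by (simp add: is_unit_pCons_iff)
  qed
  then show ?thesis
    unfolding regular_rational_at_def using f by blast
qed

section \<open>Limits of rational functions at infinity\<close>

text \<open>Here \<open>m\<close> only bounds the degree, so \<open>coeff p m\<close> may be 0. This
  treats numerators of degree m and of lower degree alike.\<close>

lemma poly_divide_power_at_top:
  fixes p :: "real poly"
  assumes "degree p \<le> m"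
  shows "((\<lambda>x. poly p x / x ^ m) \<longlongrightarrow> coeff p m) at_top"
proof -
  have lim: "((\<lambda>x. coeff p i * inverse x ^ (m - i)) \<longlongrightarrow> (if i = m then coeff p m else 0)) at_top"
    if "i \<le> m" for i
  proof (cases "i = m")
    case False
    with that have "0 < m - i"
      by simp
    then have "((\<lambda>x::real. coeff p i * inverse x ^ (m - i)) \<longlongrightarrow> coeff p i * 0 ^ (m - i)) at_top"
      by (intro tendsto_intros tendsto_inverse_0_at_top filterlim_ident)
    moreover have "(0::real) ^ (m - i) = 0"
      using \<open>0 < m - i\<close> by (rule zero_power)
    ultimately show ?thesis
      using False by simp
  qed simp
  have "((\<lambda>x. \<Sum>i\<le>m. coeff p i * inverse x ^ (m - i)) \<longlongrightarrow>
      (\<Sum>i\<le>m. if i = m then coeff p m else 0)) at_top"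
    by (intro tendsto_sum lim) simp
  moreover have "eventually (\<lambda>x. (\<Sum>i\<le>m. coeff p i * inverse x ^ (m - i)) = poly p x / x ^ m) at_top"
    using eventually_gt_at_top[of 0]
  proof eventually_elim
    case (elim x)
    have "poly p x = (\<Sum>i\<le>m. coeff p i * x ^ i)"
      unfolding poly_altdef using assms
      by (intro sum.mono_neutral_left) (auto intro: le_degree)
    also have "\<dots> / x ^ m = (\<Sum>i\<le>m. coeff p i * inverse x ^ (m - i))"
      using elim unfolding sum_divide_distrib
      by (intro sum.cong) (auto simp: power_diff field_simps)
    finally show ?case ..
  qed
  ultimately show ?thesis
    by (auto intro: Lim_transform_eventually)
qed

lemma poly_quotient_at_top:
  fixes p d :: "real poly"
  assumes "degree p \<le> m" and "degree d \<le> m" and "coeff d m \<noteq> 0"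
  shows "((\<lambda>x. poly p x / poly d x) \<longlongrightarrow> coeff p m / coeff d m) at_top"
proof -
  have "((\<lambda>x. (poly p x / x ^ m) / (poly d x / x ^ m)) \<longlongrightarrow> coeff p m / coeff d m) at_top"
    using assms by (intro tendsto_divide poly_divide_power_at_top)
  moreover have "eventually (\<lambda>x. (poly p x / x ^ m) / (poly d x / x ^ m) = poly p x / poly d x) at_top"
    using eventually_gt_at_top[of 0] by eventually_elim simp
  ultimately show ?thesis
    by (rule Lim_transform_eventually)
qed

section \<open>The parametric stability function as a quotient of polynomials\<close>

definition coeff_poly :: "nat \<Rightarrow> (nat \<Rightarrow> real) \<Rightarrow> real poly" where
  "coeff_poly n a = (\<Sum>i\<le>n. monom (a i) i)"

lemma coeff_coeff_poly: "coeff (coeff_poly n a) k = (if k \<le> n then a k else 0)"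
  by (simp add: coeff_poly_def coeff_sum)

lemma poly_coeff_poly: "poly (coeff_poly n a) x = (\<Sum>i\<le>n. a i * x ^ i)"
  by (simp add: coeff_poly_def poly_sum poly_monom)

lemma degree_coeff_poly: "degree (coeff_poly n a) \<le> n"
  by (rule degree_le) (simp add: coeff_coeff_poly)

text \<open>Since \<open>exp (b 0) = 1\<close>, the separate 1 in the denominator becomes the term
  of index 0.\<close>

lemma param_stab_poly:
  assumes "b 0 = 0"
  shows "param_stab n m a b x =
    poly (coeff_poly n a) x / poly (coeff_poly m (\<lambda>i. exp (b i))) x"
  using assms
  by (simp add: param_stab_def poly_coeff_poly atLeast0AtMost[symmetric] sum.atLeast_Suc_atMost)

lemma regular_rational_at_param_stab:
  assumes "b 0 = 0"
  shows "regular_rational_at 0 (param_stab n m a b)"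
  unfolding regular_rational_at_def
proof (intro exI conjI allI impI)
  show "poly (coeff_poly m (\<lambda>i. exp (b i))) 0 \<noteq> 0"
    by (simp add: poly_0_coeff_0 coeff_coeff_poly)
qed (rule param_stab_poly[where b = b, OF assms])

section \<open>Order of the stability function at 0\<close>

lemma exp_minus_taylor_bigo:
  "(\<lambda>x::real. exp (- x) - (\<Sum>l=0..q. (- x) ^ l / fact l)) \<in> O[at 0](\<lambda>x. x ^ (q + 1))"
proof (rule bigoI)
  have "eventually (\<lambda>x::real. \<bar>x\<bar> < 1) (at 0)"
    by (rule eventually_at_filter[THEN iffD2], rule eventually_nhds_metric[THEN iffD2])
       (auto intro!: exI[of _ 1])
  \<comment> \<open>The constant \<open>exp 1\<close> bounds the factor
    \<open>exp t / fact (Suc q)\<close> of the Lagrange remainder, because \<open>t\<close> lies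
    within distance \<open>\<bar>x\<bar> < 1\<close> of 0.\<close>
  then show "eventually (\<lambda>x::real. norm (exp (- x) - (\<Sum>l=0..q. (- x) ^ l / fact l)) \<le>
      exp 1 * norm (x ^ (q + 1))) (at 0)"
  proof eventually_elim
    case (elim x)
    obtain t where t: "\<bar>t\<bar> \<le> \<bar>- x\<bar>" and
      e: "exp (- x) = (\<Sum>l<Suc q. (- x) ^ l / fact l) + exp t / fact (Suc q) * (- x) ^ Suc q"
      using Maclaurin_exp_le[of "- x" "Suc q"] by blast
    have "exp (- x) - (\<Sum>l=0..q. (- x) ^ l / fact l) = exp t / fact (Suc q) * (- x) ^ Suc q"
      unfolding e by (simp add: atLeast0AtMost lessThan_Suc_atMost)
    moreover have "exp t / fact (Suc q) \<le> exp 1 / 1"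
      using t elim by (intro frac_le) (auto simp del: fact_Suc)
    ultimately show ?case
      using mult_right_mono[of "exp t / fact (Suc q)" "exp 1" "\<bar>x\<bar> ^ Suc q"]
      by (simp add: abs_mult power_abs del: fact_Suc power_Suc)
  qed
qed

text \<open>The order constraints are a Cauchy product: up to degree q, the numerator
  \<open>N\<close> has the coefficients of \<open>T * E\<close>, where \<open>T\<close> is the
  Taylor polynomial of exp (-x) and \<open>E\<close> the denominator. Hence \<open>N - T * E\<close>
  is divisible by the power q + 1 of x, and so is R - T up to a factor regular at 0.\<close>

lemma param_stab_order:
  assumes oc: "order_constraints q a b" and "q \<le> n" "q \<le> m"
  shows "(\<lambda>x. param_stab n m a b x - exp (- x)) \<in> O[at 0](\<lambda>x. x ^ (q + 1))"
proof -
  define N where "N = coeff_poly n a"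
  define E where "E = coeff_poly m (\<lambda>i. exp (b i))"
  define T where "T = coeff_poly q (\<lambda>l. (-1) ^ l / fact l)"
  have b0: "b 0 = 0" and a: "\<And>k. k \<le> q \<Longrightarrow> a k = (\<Sum>j=0..k. (-1) ^ j / fact j * exp (b (k - j)))"
    using oc by (auto simp: order_constraints_def)
  \<comment> \<open>The bounds \<open>q \<le> n\<close> and \<open>q \<le> m\<close> ensure that no
    coefficient of index at most q is cut off in \<open>N\<close> or \<open>E\<close>.\<close>
  have "coeff (N - T * E) k = 0" if "k < q + 1" for k
    using that \<open>q \<le> n\<close> \<open>q \<le> m\<close>
    by (auto simp: N_def T_def E_def coeff_mult coeff_coeff_poly a atLeast0AtMost intro!: sum.cong)
  then have "monom 1 (q + 1) dvd N - T * E"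
    by (simp add: monom_1_dvd_iff')
  then obtain S where S: "N - T * E = monom 1 (q + 1) * S"
    by blast
  have E0: "poly E 0 \<noteq> 0"
    by (simp add: E_def poly_0_coeff_0 coeff_coeff_poly)
  have T: "poly T x = (\<Sum>l=0..q. (- x) ^ l / fact l)" for x
    unfolding T_def poly_coeff_poly atLeast0AtMost
    by (intro sum.cong refl) (simp add: power_minus[of x])
  have "regular_rational_at 0 (\<lambda>x. poly S x / poly E x)"
    unfolding regular_rational_at_def using E0 by blast
  from landau_o.big.mult[OF landau_o.big_refl[of "\<lambda>x. x ^ (q + 1)"] regular_rational_at_bigo[OF this]]
  have "(\<lambda>x. x ^ (q + 1) * (poly S x / poly E x)) \<in> O[at 0](\<lambda>x. x ^ (q + 1))"
    by simp
  from this exp_minus_taylor_bigo[of q]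
  have "(\<lambda>x. x ^ (q + 1) * (poly S x / poly E x)
      - (exp (- x) - (\<Sum>l=0..q. (- x) ^ l / fact l))) \<in> O[at 0](\<lambda>x. x ^ (q + 1))"
    by (rule sum_in_bigo(2))
  moreover have eq: "eventually (\<lambda>x. x ^ (q + 1) * (poly S x / poly E x)
      - (exp (- x) - (\<Sum>l=0..q. (- x) ^ l / fact l)) = param_stab n m a b x - exp (- x)) (at 0)"
    using eventually_poly_nonzero[OF E0] unfolding eventually_at_filter
  proof eventually_elim
    case (elim x)
    have "poly N x - poly T x * poly E x = x ^ (q + 1) * poly S x"
      using arg_cong[OF S, of "\<lambda>p. poly p x"] by (simp add: poly_monom)
    then have "x ^ (q + 1) * (poly S x / poly E x) = poly N x / poly E x - poly T x"
      using elim by (simp add: field_simps)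
    then show ?case
      using param_stab_poly[of b n m a x, OF b0] by (simp add: T[symmetric] N_def E_def)
  qed
  ultimately show ?thesis
    by (subst (asm) landau_o.big.in_cong[OF eq])
qed

text \<open>The exponents balance as (q + 1) - (j + 1) = q - j; for j = q boundedness
  remains.\<close>

lemma divide_power_bigo:
  fixes f :: "real \<Rightarrow> real"
  assumes "f \<in> O[at 0](\<lambda>x. x ^ (q + 1))" and "j \<le> q"
  shows "(\<lambda>x. fact j / (- x) ^ (j + 1) * f x) \<in> O[at 0](\<lambda>x. x ^ (q - j))"
proof -
  obtain K where "K > 0" and K: "eventually (\<lambda>x. norm (f x) \<le> K * norm (x ^ (q + 1))) (at 0)"
    using assms(1) by (rule landau_o.bigE)
  show ?thesis
  proof (rule bigoI[where c = "fact j * K"])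
    show "eventually (\<lambda>x. norm (fact j / (- x) ^ (j + 1) * f x) \<le>
        fact j * K * norm (x ^ (q - j))) (at 0)"
      using K eventually_neq_at_within[of 0 0 UNIV]
    proof eventually_elim
      case (elim x)
      have "\<bar>x\<bar> ^ (q + 1) = \<bar>x\<bar> ^ (q - j) * \<bar>x\<bar> ^ (j + 1)"
        using assms(2) by (simp flip: power_add)
      then have "\<bar>f x\<bar> \<le> K * \<bar>x\<bar> ^ (q - j) * \<bar>x\<bar> ^ (j + 1)"
        using elim(1) by (simp add: power_abs abs_mult mult.assoc del: power_Suc power_add)
      then have "\<bar>f x\<bar> / \<bar>x\<bar> ^ (j + 1) \<le> K * \<bar>x\<bar> ^ (q - j)"
        using elim(2) by (subst pos_divide_le_eq) (auto simp del: power_Suc)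
      then have "fact j * (\<bar>f x\<bar> / \<bar>x\<bar> ^ (j + 1)) \<le> fact j * (K * \<bar>x\<bar> ^ (q - j))"
        by (intro mult_left_mono) auto
      then show ?case
        by (simp add: abs_mult power_abs mult.assoc del: power_Suc)
    qed
  qed
qed

section \<open>Strong stability of optimal parameters\<close>

text \<open>The coefficient \<open>exp (b m)\<close> is never 0, so the denominator has exact degree
  m; the numerator reaches that degree only if n = m.\<close>

lemma param_stab_at_top:
  assumes "b 0 = 0" and "n \<le> m"
  shows "(param_stab n m a b \<longlongrightarrow> (if n = m then a n else 0) / exp (b m)) at_top"
proof -
  have "((\<lambda>x. poly (coeff_poly n a) x / poly (coeff_poly m (\<lambda>i. exp (b i))) x) \<longlongrightarrow>
      coeff (coeff_poly n a) m / coeff (coeff_poly m (\<lambda>i. exp (b i))) m) at_top"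
    using assms(2) order_trans[OF degree_coeff_poly]
    by (intro poly_quotient_at_top degree_coeff_poly) (auto simp: coeff_coeff_poly)
  then show ?thesis
    using assms(2)
    by (simp add: coeff_coeff_poly param_stab_poly[of b, OF assms(1), abs_def] cong: if_cong split: if_splits)
qed

lemma alternating_exp_partial_sum_bounds:
  "0 \<le> (\<Sum>j=0..k. (-1) ^ j / fact j :: real) \<and> (\<Sum>j=0..k. (-1) ^ j / fact j :: real) \<le> 1"
proof -
  \<comment> \<open>The bounds alone are not inductive. The added clause leaves a margin of
    \<open>1 / fact k\<close> on the side towards which the next term moves, and that term is no
    larger than the margin.\<close>
  have "0 \<le> (\<Sum>j=0..k. (-1) ^ j / fact j :: real) \<and> (\<Sum>j=0..k. (-1) ^ j / fact j :: real) \<le> 1 \<and>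
    (if even k then 1 / fact k \<le> (\<Sum>j=0..k. (-1) ^ j / fact j :: real)
     else (\<Sum>j=0..k. (-1) ^ j / fact j :: real) \<le> 1 - 1 / fact k)"
  proof (induction k)
    case (Suc k)
    have "1 / fact (Suc k) \<le> (1 / fact k :: real)"
      by (intro divide_left_mono fact_mono) auto
    moreover have "1 / fact (Suc k) \<ge> (0 :: real)"
      by simp
    moreover have "(\<Sum>j=0..Suc k. (-1) ^ j / fact j :: real) = (\<Sum>j=0..k. (-1) ^ j / fact j)
        + (if even k then - (1 / fact (Suc k)) else 1 / fact (Suc k))"
      by (simp del: fact_Suc)
    ultimately show ?case
      using Suc.IH by (cases "even k") (simp_all only: even_Suc if_True if_False simp_thms, linarith+)
  qed simp
  then show ?thesis
    by blast
qed

text \<open>With all \<open>b i = 0\<close> every denominator coefficient is 1, so numerator and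
  denominator compare term by term. The limit is 0 because \<open>a n = 0\<close> for q < n.\<close>

lemma ex_feasible:
  assumes "q < m" and "q < n" and "n \<le> m"
  shows "\<exists>a b. feasible q n m a b \<and> (param_stab n m a b \<longlongrightarrow> 0) at_top"
proof -
  define b :: "nat \<Rightarrow> real" where "b = (\<lambda>_. 0)"
  define a :: "nat \<Rightarrow> real" where "a = (\<lambda>k. if k \<le> q then \<Sum>j=0..k. (-1) ^ j / fact j else 0)"
  have a: "0 \<le> a k" "a k \<le> 1" for k
    using alternating_exp_partial_sum_bounds[of k] by (auto simp: a_def)
  have "\<bar>param_stab n m a b x\<bar> < 1" if "x > 0" for x
  proof -
    have "0 \<le> (\<Sum>i\<le>n. a i * x ^ i)"
      using that a by (intro sum_nonneg) auto
    moreover have "(\<Sum>i\<le>n. a i * x ^ i) = (\<Sum>i\<le>m. a i * x ^ i)"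
      using assms by (intro sum.mono_neutral_left) (auto simp: a_def)
    moreover have "(\<Sum>i\<le>m. a i * x ^ i) < (\<Sum>i\<le>m. 1 * x ^ i)"
    proof (rule sum_strict_mono_ex1)
      show "\<forall>i\<in>{..m}. a i * x ^ i \<le> 1 * x ^ i"
        using that a by (intro ballI mult_right_mono) auto
      \<comment> \<open>Strictness comes from the index m > q, where \<open>a m = 0\<close> faces
        the coefficient 1.\<close>
      show "\<exists>i\<in>{..m}. a i * x ^ i < 1 * x ^ i"
        using that \<open>q < m\<close> by (intro bexI[of _ m]) (auto simp: a_def)
    qed simp
    ultimately show ?thesis
      by (subst param_stab_poly) (simp_all add: b_def poly_coeff_poly)
  qed
  then have "feasible q n m a b"
    by (auto simp: feasible_def order_constraints_def a_def b_def)
  moreover have "(param_stab n m a b \<longlongrightarrow> 0) at_top"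
    using param_stab_at_top[of b n m a] assms by (auto simp: b_def a_def split: if_splits)
  ultimately show ?thesis
    by blast
qed

text \<open>The quotients converge along \<open>s\<close>, since
  \<open>\<bar>L\<bar> \<noteq> 1\<close> keeps the denominators away from 0 in the limit, and a
  convergent real sequence is bounded. An early term with \<open>\<bar>R (s j)\<bar> = 1\<close>
  does no harm: division returns 0 there.\<close>

lemma conv_factor_finite:
  assumes r: "(r \<longlongrightarrow> \<rho>) at_top" and R: "(R \<longlongrightarrow> L) at_top" and "\<bar>L\<bar> \<noteq> 1" and "J0 \<ge> 1"
    and s: "filterlim s at_top sequentially"
  shows "\<exists>K. conv_factor (range s) r R J0 \<le> ereal K"
proof -
  have "filterlim (\<lambda>j. s j * (1 / real J0)) at_top sequentially"
    using \<open>J0 \<ge> 1\<close> s by (intro filterlim_at_top_mult_tendsto_pos[where c = "1 / real J0"]) auto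
  then have "(\<lambda>j. r (s j / real J0)) \<longlonglongrightarrow> \<rho>"
    by (intro filterlim_compose[OF r]) simp
  moreover have "(\<lambda>j. R (s j)) \<longlonglongrightarrow> L"
    by (rule filterlim_compose[OF R s])
  ultimately have "(\<lambda>j. (r (s j / real J0) ^ J0 - R (s j)) / (1 - \<bar>R (s j)\<bar>))
      \<longlonglongrightarrow> (\<rho> ^ J0 - L) / (1 - \<bar>L\<bar>)"
    using \<open>\<bar>L\<bar> \<noteq> 1\<close> by (intro tendsto_intros) auto
  then have "Bseq (\<lambda>j. (r (s j / real J0) ^ J0 - R (s j)) / (1 - \<bar>R (s j)\<bar>))"
    by (intro convergent_imp_Bseq convergentI)
  then obtain K where "\<And>j. \<bar>(r (s j / real J0) ^ J0 - R (s j)) / (1 - \<bar>R (s j)\<bar>)\<bar> \<le> K"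
    by (auto simp: Bseq_def)
  then show ?thesis
    unfolding conv_factor_def by (intro exI[of _ K] SUP_least) auto
qed

text \<open>Clearing the denominator and passing to the limit gives
  \<open>\<bar>\<rho> ^ J0 - L\<bar> \<le> K * (1 - \<bar>L\<bar>)\<close>. If L had modulus 1, the
  right side would be 0 and L would equal \<open>\<rho> ^ J0\<close>, which has modulus less than
  1.\<close>

lemma conv_factor_finite_imp_limit_lt_1:
  assumes r: "(r \<longlongrightarrow> \<rho>) at_top" and "\<bar>\<rho>\<bar> < 1" and R: "(R \<longlongrightarrow> L) at_top" and "J0 \<ge> 1"
    and s: "filterlim s at_top sequentially" and lt: "\<And>j. \<bar>R (s j)\<bar> < 1"
    and K: "conv_factor (range s) r R J0 \<le> ereal K"
  shows "\<bar>L\<bar> < 1"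
proof -
  have "filterlim (\<lambda>j. s j * (1 / real J0)) at_top sequentially"
    using \<open>J0 \<ge> 1\<close> s by (intro filterlim_at_top_mult_tendsto_pos[where c = "1 / real J0"]) auto
  then have r': "(\<lambda>j. r (s j / real J0)) \<longlonglongrightarrow> \<rho>"
    by (intro filterlim_compose[OF r]) simp
  have R': "(\<lambda>j. R (s j)) \<longlonglongrightarrow> L"
    by (rule filterlim_compose[OF R s])
  have le: "\<bar>r (s j / real J0) ^ J0 - R (s j)\<bar> \<le> K * (1 - \<bar>R (s j)\<bar>)" for j
  proof -
    have "ereal \<bar>(r (s j / real J0) ^ J0 - R (s j)) / (1 - \<bar>R (s j)\<bar>)\<bar> \<le> ereal K"
      by (rule order_trans[OF _ K]) (auto simp: conv_factor_def intro: SUP_upper2)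
    then show ?thesis
      using lt[of j] by (simp add: field_simps)
  qed
  have limit_le: "\<bar>\<rho> ^ J0 - L\<bar> \<le> K * (1 - \<bar>L\<bar>)"
    by (rule LIMSEQ_le[of "\<lambda>j. \<bar>r (s j / real J0) ^ J0 - R (s j)\<bar>" _
          "\<lambda>j. K * (1 - \<bar>R (s j)\<bar>)"]) (use le in \<open>auto intro!: tendsto_intros r' R'\<close>)
  have "\<bar>L\<bar> \<le> 1"
    by (rule LIMSEQ_le_const2[OF tendsto_rabs[OF R']]) (use lt less_imp_le in blast)
  moreover have "\<bar>L\<bar> \<noteq> 1"
  proof
    assume "\<bar>L\<bar> = 1"
    with limit_le have "\<bar>\<rho>\<bar> ^ J0 = 1"
      by (simp flip: power_abs)
    moreover have "\<bar>\<rho>\<bar> ^ J0 < 1"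
      using \<open>\<bar>\<rho>\<bar> < 1\<close> \<open>J0 \<ge> 1\<close> by (simp add: power_less_one_iff)
    ultimately show False
      by simp
  qed
  ultimately show ?thesis
    by simp
qed

text \<open>Feasibility bounds the limit at infinity only by 1 in modulus; comparison with the
  candidate of \<open>ex_feasible\<close> makes the optimal convergence factor finite and so
  excludes equality.\<close>

lemma optimal_strongly_stable:
  assumes r: "(r \<longlongrightarrow> \<rho>) at_top" "\<bar>\<rho>\<bar> < 1" and "J0 \<ge> 1" and "q < n" and "n \<le> m"
    and s: "filterlim s at_top sequentially" "\<And>j. s j > 0"
    and opt: "optimal (range s) r J0 q n m a b"
  shows "strongly_stable (param_stab n m a b)"
proof -
  have feas: "feasible q n m a b"
    using opt by (simp add: optimal_def)
  then have b0: "b 0 = 0" and lt: "\<And>x. x > 0 \<Longrightarrow> \<bar>param_stab n m a b x\<bar> < 1"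
    by (auto simp: feasible_def order_constraints_def)
  obtain a' b' where feas': "feasible q n m a' b'" and lim': "(param_stab n m a' b' \<longlongrightarrow> 0) at_top"
    using ex_feasible[of q m n] assms(4,5) by auto
  obtain K where "conv_factor (range s) r (param_stab n m a' b') J0 \<le> ereal K"
    using conv_factor_finite[OF r(1) lim' _ \<open>J0 \<ge> 1\<close> s(1)] by auto
  moreover have "conv_factor (range s) r (param_stab n m a b) J0
      \<le> conv_factor (range s) r (param_stab n m a' b') J0"
    using opt feas' by (auto simp: optimal_def)
  ultimately have K: "conv_factor (range s) r (param_stab n m a b) J0 \<le> ereal K"
    by (rule order_trans[rotated])
  have lim: "(param_stab n m a b \<longlongrightarrow> (if n = m then a n else 0) / exp (b m)) at_top"
    using b0 \<open>n \<le> m\<close> by (rule param_stab_at_top)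
  moreover have "\<bar>(if n = m then a n else 0) / exp (b m)\<bar> < 1"
    by (rule conv_factor_finite_imp_limit_lt_1[OF r lim \<open>J0 \<ge> 1\<close> s(1) lt[OF s(2)] K])
  ultimately show ?thesis
    unfolding strongly_stable_def using lt by blast
qed

section \<open>Order conditions of the propagator\<close>

text \<open>The defining equations hold for x > 0, whereas the order conditions concern both sides
  of 0. The identity theorem for rational functions closes this gap.\<close>

lemma strict_accuracy_eventually:
  assumes R: "regular_rational_at 0 R" and P: "\<And>i. i \<in> I \<Longrightarrow> regular_rational_at 0 (P i)"
    and eq: "\<And>x. x > 0 \<Longrightarrow> (\<Sum>i\<in>I. w i * P i x)
      - fact j / (- x) ^ (j + 1) * (R x - (\<Sum>l=0..j. (- x) ^ l / fact l)) = 0"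
  shows "eventually (\<lambda>x. (\<Sum>i\<in>I. w i * P i x)
      = fact j / (- x) ^ (j + 1) * (R x - (\<Sum>l=0..j. (- x) ^ l / fact l))) (at 0)"
proof -
  define T where "T = coeff_poly j (\<lambda>l. (-1) ^ l / fact l)"
  have T: "poly T x = (\<Sum>l=0..j. (- x) ^ l / fact l)" for x
    unfolding T_def poly_coeff_poly atLeast0AtMost
    by (intro sum.cong refl) (simp add: power_minus[of x])
  \<comment> \<open>The polynomial \<open>[:0, -1:]\<close> is -x. Its power clears the denominator
    of the equation, so that \<open>?F\<close> is visibly regular at 0; off 0 nothing is
    lost.\<close>
  let ?F = "\<lambda>x. poly ([:0, -1:] ^ (j + 1)) x * (\<Sum>i\<in>I. w i * P i x)
    + (- fact j) * (R x + poly (- T) x)"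
  have "regular_rational_at 0 ?F"
    by (intro regular_rational_at_add regular_rational_at_mult regular_rational_at_poly
        regular_rational_at_const regular_rational_at_sum R P)
  moreover have F: "?F x = 0 \<longleftrightarrow> (\<Sum>i\<in>I. w i * P i x)
      = fact j / (- x) ^ (j + 1) * (R x - (\<Sum>l=0..j. (- x) ^ l / fact l))" if "x \<noteq> 0" for x
  proof -
    have "(- x) ^ (j + 1) \<noteq> 0"
      using that by simp
    then show ?thesis
      by (simp add: T poly_power field_simps del: power_Suc)
  qed
  moreover have "?F x = 0" if "x > 0" for x
    using F[of x] eq[OF that] that by (simp only: eq_iff_diff_eq_0[of "sum _ _"])
  ultimately have "eventually (\<lambda>x. ?F x = 0) (at 0)"
    by (intro regular_rational_at_eventually_zero)
  then show ?thesis
    using eventually_neq_at_within[of 0 0 UNIV]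
    by eventually_elim (use F in blast)
qed

theorem proposition3p3:
  fixes D :: "'a::{real_inner,complete_space} set" and A :: "'a \<Rightarrow> 'a"
    and lam :: "nat \<Rightarrow> real" and \<phi> :: "nat \<Rightarrow> 'a"
    and \<Delta>T :: real and r :: "real \<Rightarrow> real" and qf J0 q n m M :: nat
    and a b C :: "nat \<Rightarrow> real" and P :: "nat \<Rightarrow> real \<Rightarrow> real"
    and G :: "real \<Rightarrow> real \<Rightarrow> 'a \<Rightarrow> (real \<Rightarrow> 'a) \<Rightarrow> 'a"
  assumes "posdef_selfadjoint_compact_inverse D A"
    and "eigensystem D A lam \<phi>"
    and "\<Delta>T > 0"
    and "rational_function r"
    and "strongly_stable r"
    and "(\<lambda>x. r x - exp (- x)) \<in> O[at 0](\<lambda>x. x ^ (qf + 1))"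
    and "J0 \<ge> 1"
    and "1 \<le> q" and "q < n" and "n \<le> m"
    and "optimal {\<Delta>T * lam j | j. True} r J0 q n m a b"
    and "is_ocp lam \<phi> q (param_stab n m a b) M C P G"
  shows "(\<lambda>x. param_stab n m a b x - exp (- x)) \<in> O[at 0](\<lambda>x. x ^ (q + 1)) \<and>
    (\<forall>j\<le>q. (\<lambda>x. (\<Sum>i=1..M. C i ^ j * P i x)
        - fact j / (- x) ^ (j + 1) * (exp (- x) - (\<Sum>l=0..j. (- x) ^ l / fact l)))
      \<in> O[at 0](\<lambda>x. x ^ (q - j))) \<and>
    strongly_stable (param_stab n m a b)"
proof -
  have feas: "feasible q n m a b"
    using assms(11) by (simp add: optimal_def)
  then have oc: "order_constraints q a b" and b0: "b 0 = 0"
    by (auto simp: feasible_def order_constraints_def)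
  have order: "(\<lambda>x. param_stab n m a b x - exp (- x)) \<in> O[at 0](\<lambda>x. x ^ (q + 1))"
    using oc \<open>q < n\<close> \<open>n \<le> m\<close> by (intro param_stab_order) auto
  have P: "regular_rational_at 0 (P i)" if "i \<in> {1..M}" for i
    using assms(12) that by (intro bounded_rational_function_regular) (auto simp: is_ocp_def)
  have accuracy: "(\<lambda>x. (\<Sum>i=1..M. C i ^ j * P i x)
      - fact j / (- x) ^ (j + 1) * (exp (- x) - (\<Sum>l=0..j. (- x) ^ l / fact l)))
      \<in> O[at 0](\<lambda>x. x ^ (q - j))" if "j \<le> q" for j
  proof (cases "j = q")
    \<comment> \<open>No defining equation is available for j = q, but only O(1) is claimed: the sum
      is regular at 0, and the Taylor remainder of degree q divided by the power q + 1 of x is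
      bounded near 0.\<close>
    case True
    have "regular_rational_at 0 (\<lambda>x. \<Sum>i=1..M. C i ^ j * P i x)"
      by (intro regular_rational_at_sum regular_rational_at_mult regular_rational_at_const P)
    then have "(\<lambda>x. \<Sum>i=1..M. C i ^ j * P i x) \<in> O[at 0](\<lambda>x. x ^ (q - j))"
      using regular_rational_at_bigo True by simp
    moreover have "(\<lambda>x::real. fact j / (- x) ^ (j + 1) * (exp (- x) - (\<Sum>l=0..j. (- x) ^ l / fact l)))
        \<in> O[at 0](\<lambda>x. x ^ (q - j))"
      unfolding True by (intro divide_power_bigo exp_minus_taylor_bigo order_refl)
    ultimately show ?thesis
      by (rule sum_in_bigo(2))
  next
    case False
    with that have "j < q"
      by simp
    have "eventually (\<lambda>x. (\<Sum>i=1..M. C i ^ j * P i x)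
        = fact j / (- x) ^ (j + 1) * (param_stab n m a b x - (\<Sum>l=0..j. (- x) ^ l / fact l))) (at 0)"
    proof (rule strict_accuracy_eventually[OF regular_rational_at_param_stab[of b, OF b0] P])
      show "(\<Sum>i=1..M. C i ^ j * P i x)
          - fact j / (- x) ^ (j + 1) * (param_stab n m a b x - (\<Sum>l=0..j. (- x) ^ l / fact l)) = 0"
        if "x > 0" for x
        using assms(12) \<open>j < q\<close> that unfolding is_ocp_def by blast
    qed
    \<comment> \<open>The Taylor polynomials cancel, and the defect becomes the order error of R
      divided by a power of x.\<close>
    then have "eventually (\<lambda>x. fact j / (- x) ^ (j + 1) * (param_stab n m a b x - exp (- x))
        = (\<Sum>i=1..M. C i ^ j * P i x)
          - fact j / (- x) ^ (j + 1) * (exp (- x) - (\<Sum>l=0..j. (- x) ^ l / fact l))) (at 0)"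
      by eventually_elim (simp only: right_diff_distrib diff_diff_eq2 diff_add_cancel)
    from landau_o.big.in_cong[OF this] divide_power_bigo[OF order that] show ?thesis
      by blast
  qed
  obtain \<rho> where r: "(r \<longlongrightarrow> \<rho>) at_top" "\<bar>\<rho>\<bar> < 1"
    using assms(5) unfolding strongly_stable_def by blast
  have lam: "\<And>j. 0 < lam j" "filterlim lam at_top sequentially"
    using assms(2) by (auto simp: eigensystem_def)
  have "strongly_stable (param_stab n m a b)"
  proof (rule optimal_strongly_stable[OF r \<open>J0 \<ge> 1\<close> \<open>q < n\<close> \<open>n \<le> m\<close>])
    show "filterlim (\<lambda>j. \<Delta>T * lam j) at_top sequentially"
      using \<open>\<Delta>T > 0\<close> lam(2) by (intro filterlim_tendsto_pos_mult_at_top[OF tendsto_const])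
    show "\<Delta>T * lam j > 0" for j
      using \<open>\<Delta>T > 0\<close> lam(1) by simp
    show "optimal (range (\<lambda>j. \<Delta>T * lam j)) r J0 q n m a b"
      using assms(11) by (simp add: full_SetCompr_eq)
  qed
  with order accuracy show ?thesis
    by blast
qed

end
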